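(* For all non-negative integers $i$, $j$ and $n$, \[p(i,j,n)=p'(i,j,n),\] where $p(i,j,n)$ is the number of partitions of $n$ into distinct parts with exactly $i$ odd-indexed odd parts and exactly $j$ even-indexed odd parts, and $p'(i,j,n)$ is the number of partitions of $n$ into distinct parts with exactly $i$ parts congruent to $1$ modulo $4$ and exactly $j$ parts congruent to $3$ modulo $4$.
   Context: A partition $\pi=(\lambda_1,\lambda_2,\dots)$ is a finite non-increasing sequence of positive integers (its parts); it is a partition of $n$ if the parts sum to $n$. The empty sequence is the unique partition of $0$. The parts $\lambda_{2r-1}$ ($r\ge 1$) are called odd-indexed and the parts $\lambda_{2r}$ ($r\geq 1$) even-indexed. An odd-indexed (even-indexed) odd part is an odd-indexed (even-indexed) part whose value is odd. *)

theory Defs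
  imports Main
begin

definition partition_of :: "nat \<Rightarrow> nat list \<Rightarrow> bool" where
  "partition_of n xs \<longleftrightarrow> sorted_wrt (\<ge>) xs \<and> (\<forall>x\<in>set xs. 0 < x) \<and> sum_list xs = n"

definition distinct_partitions :: "nat \<Rightarrow> nat list set" where
  "distinct_partitions n = {xs. partition_of n xs \<and> distinct xs}"

text \<open>
  Parts are indexed from 1 in the mathematics but from 0 in a list: the part with
  index \<open>k + 1\<close> is \<open>xs ! k\<close>.
\<close>

definition num_odd_indexed_odd_parts :: "nat list \<Rightarrow> nat" where
  "num_odd_indexed_odd_parts xs = card {k. k < length xs \<and> odd (k + 1) \<and> odd (xs ! k)}"

definition num_even_indexed_odd_parts :: "nat list \<Rightarrow> nat" where
  "num_even_indexed_odd_parts xs = card {k. k < length xs \<and> even (k + 1) \<and> odd (xs ! k)}"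

definition num_parts_mod4 :: "nat \<Rightarrow> nat list \<Rightarrow> nat" where
  "num_parts_mod4 r xs = card {k. k < length xs \<and> xs ! k mod 4 = r}"

text \<open>The counts \<open>p(i, j, n)\<close> and \<open>p'(i, j, n)\<close>, in this order.\<close>

definition num_partitions_by_index :: "nat \<Rightarrow> nat \<Rightarrow> nat \<Rightarrow> nat" where
  "num_partitions_by_index i j n = card {xs \<in> distinct_partitions n.
     num_odd_indexed_odd_parts xs = i \<and> num_even_indexed_odd_parts xs = j}"

definition num_partitions_by_mod4 :: "nat \<Rightarrow> nat \<Rightarrow> nat \<Rightarrow> nat" where
  "num_partitions_by_mod4 i j n = card {xs \<in> distinct_partitions n.
     num_parts_mod4 1 xs = i \<and> num_parts_mod4 3 xs = j}"

text \<open>Both counts are over subsets of this set, so \<open>card\<close> is a true cardinality.\<close>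

lemma finite_distinct_partitions: "finite (distinct_partitions n)"
proof (rule finite_subset)
  have "length xs \<le> sum_list xs" if "\<forall>x\<in>set xs. 0 < x" for xs :: "nat list"
    using that by (induction xs) (auto simp: Suc_le_eq)
  moreover have "x \<le> sum_list xs" if "x \<in> set xs" for x and xs :: "nat list"
    using that by (simp add: member_le_sum_list)
  ultimately show "distinct_partitions n \<subseteq> {xs. set xs \<subseteq> {..n} \<and> length xs \<le> n}"
    by (auto simp: distinct_partitions_def partition_of_def)
  show "finite {xs. set xs \<subseteq> {..n} \<and> length xs \<le> n}"
    by (rule finite_lists_length_le) simp
qed

end

theory Submission
  imports Defs "HOL-Computational_Algebra.Formal_Power_Series"
begin

text \<open>
  Write \<open>A(i, j)\<close> for the generating function of strict partitions with parts at most
  \<open>2m\<close> having \<open>i\<close> odd-indexed and \<open>j\<close> even-indexed odd parts. Removing the largest part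
  swaps the two kinds of index, which gives a recurrence in \<open>m\<close> whose solution, with
  \<open>r = m - i - j\<close>, \<open>Q = q ^ 4\<close> and \<open>w = 2 * i ^ 2 - i + 2 * j ^ 2 + j\<close>, is
  \<open>A(i, j) = q ^ w (Q; Q)_m (-q ^ 2; q ^ 2)_r / ((Q; Q)_i (Q; Q)_j (Q; Q)_r)\<close>.
  As \<open>m\<close> grows this tends coefficientwise to
  \<open>q ^ w (-q ^ 2; q ^ 2)_\<infinity> / ((Q; Q)_i (Q; Q)_j)\<close>, which is also the generating function
  for the statistics modulo 4: by the \<open>q\<close>-binomial theorem the parts congruent to 1 contribute
  \<open>q ^ (2 * i ^ 2 - i) / (Q; Q)_i\<close>, those congruent to 3 contribute
  \<open>q ^ (2 * j ^ 2 + j) / (Q; Q)_j\<close>, and the even parts are unrestricted.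
\<close>

unbundle fps_syntax

section \<open>Partitions with bounded parts\<close>

fun strict_lists :: "nat \<Rightarrow> nat list set" where
  "strict_lists 0 = {[]}"
| "strict_lists (Suc N) = strict_lists N \<union> (#) (Suc N) ` strict_lists N"

lemma strict_lists_eq: "strict_lists N = {xs. sorted_wrt (>) xs \<and> set xs \<subseteq> {1..N}}"
proof (induction N)
  case 0
  then show ?case by auto
next
  case (Suc N)
  have "xs \<in> strict_lists (Suc N) \<longleftrightarrow> sorted_wrt (>) xs \<and> set xs \<subseteq> {1..Suc N}" for xs
  proof (cases xs)
    case (Cons x ys)
    show ?thesis
      unfolding strict_lists.simps Suc.IH Cons by (fastforce simp: image_iff)
  qed (simp add: Suc.IH)
  then show ?case by blast
qed

lemma finite_strict_lists: "finite (strict_lists N)"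
  by (induction N) auto

lemma distinct_partitions_eq:
  assumes "n \<le> N"
  shows "distinct_partitions n = {xs \<in> strict_lists N. sum_list xs = n}"
proof -
  have "sorted_wrt (>) xs \<longleftrightarrow> sorted_wrt (\<ge>) xs \<and> distinct xs" for xs :: "nat list"
    by (induction xs) (auto simp: less_le)
  moreover have "x \<le> sum_list xs" if "x \<in> set xs" for x :: nat and xs
    using that by (simp add: member_le_sum_list)
  ultimately show ?thesis
    using assms unfolding distinct_partitions_def partition_of_def strict_lists_eq
    by (fastforce simp: Suc_le_eq)
qed

text \<open>Bounding the parts keeps the sum finite; coefficients in a field let
  \<open>fps_agree_cancel\<close> divide later.\<close>

definition part_gf :: "(nat list \<Rightarrow> bool) \<Rightarrow> nat \<Rightarrow> rat fps" where
  "part_gf P N = (\<Sum>xs | xs \<in> strict_lists N \<and> P xs. fps_X ^ sum_list xs)"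

lemma part_gf_0: "part_gf P 0 = (if P [] then 1 else 0)"
proof -
  have "{xs. xs = [] \<and> P xs} = (if P [] then {[]} else {})" by auto
  then show ?thesis by (simp add: part_gf_def)
qed

text \<open>The lists split by whether \<open>Suc N\<close> occurs. As the largest part it can only
  be the head, so the tail is counted under a shifted predicate.\<close>

lemma part_gf_Suc:
  "part_gf P (Suc N) = part_gf P N + fps_X ^ Suc N * part_gf (\<lambda>xs. P (Suc N # xs)) N"
proof -
  let ?T = "(#) (Suc N) ` {xs \<in> strict_lists N. P (Suc N # xs)}"
  have "{xs \<in> strict_lists (Suc N). P xs} = {xs \<in> strict_lists N. P xs} \<union> ?T"
    by auto
  moreover have "{xs \<in> strict_lists N. P xs} \<inter> ?T = {}"
    by (auto simp: strict_lists_eq)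
  ultimately have "part_gf P (Suc N) = part_gf P N + (\<Sum>xs\<in>?T. fps_X ^ sum_list xs)"
    using finite_strict_lists[of N] unfolding part_gf_def by (simp add: sum.union_disjoint)
  also have "(\<Sum>xs\<in>?T. fps_X ^ sum_list xs) = fps_X ^ Suc N * part_gf (\<lambda>xs. P (Suc N # xs)) N"
    unfolding part_gf_def by (subst sum.reindex) (auto simp: sum_distrib_left power_add mult.assoc)
  finally show ?thesis .
qed

lemma part_gf_nth:
  assumes "n \<le> N"
  shows "part_gf P N $ n = of_nat (card {xs \<in> distinct_partitions n. P xs})"
proof -
  have "part_gf P N $ n
      = (\<Sum>xs | xs \<in> strict_lists N \<and> P xs. if sum_list xs = n then 1 else 0)"
    by (auto simp: part_gf_def fps_sum_nth intro!: sum.cong)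
  also have "\<dots> = of_nat (card {xs \<in> {xs \<in> strict_lists N. P xs}. sum_list xs = n})"
    using finite_strict_lists[of N] by (simp add: sum.If_cases Int_def)
  also have "{xs \<in> {xs \<in> strict_lists N. P xs}. sum_list xs = n}
      = {xs \<in> distinct_partitions n. P xs}"
    by (auto simp: distinct_partitions_eq[OF assms])
  finally show ?thesis .
qed

text \<open>\<open>P\<close> sees both index and value, so one recursion serves the index statistics
  and the residue statistics.\<close>

lemma card_nth_Cons:
  "card {k. k < length (x # xs) \<and> P k ((x # xs) ! k)}
    = (if P 0 x then 1 else 0) + card {k. k < length xs \<and> P (Suc k) (xs ! k)}"
proof -
  have "{k. k < length (x # xs) \<and> P k ((x # xs) ! k)}
      = (if P 0 x then {0} else {}) \<union> Suc ` {k. k < length xs \<and> P (Suc k) (xs ! k)}"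
    by (auto simp: image_iff less_Suc_eq_0_disj split: if_splits)
  then show ?thesis
    by (simp add: card_Un_disjoint card_image)
qed

lemma num_odd_indexed_odd_parts_simps [simp]:
  "num_odd_indexed_odd_parts [] = 0"
  "num_odd_indexed_odd_parts (x # xs) = (if odd x then 1 else 0) + num_even_indexed_odd_parts xs"
  using card_nth_Cons[of x xs "\<lambda>k y. odd (k + 1) \<and> odd y"]
  by (auto simp: num_odd_indexed_odd_parts_def num_even_indexed_odd_parts_def)

lemma num_even_indexed_odd_parts_simps [simp]:
  "num_even_indexed_odd_parts [] = 0"
  "num_even_indexed_odd_parts (x # xs) = num_odd_indexed_odd_parts xs"
  using card_nth_Cons[of x xs "\<lambda>k y. even (k + 1) \<and> odd y"]
  by (auto simp: num_odd_indexed_odd_parts_def num_even_indexed_odd_parts_def)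

lemma num_parts_mod4_simps [simp]:
  "num_parts_mod4 r [] = 0"
  "num_parts_mod4 r (x # xs) = (if x mod 4 = r then 1 else 0) + num_parts_mod4 r xs"
  using card_nth_Cons[of x xs "\<lambda>k y. y mod 4 = r"]
  by (auto simp: num_parts_mod4_def)

section \<open>Product formulas\<close>

text \<open>\<open>(Q; Q)_m\<close> with \<open>Q = q ^ 4\<close>.\<close>

definition qfact4 :: "nat \<Rightarrow> rat fps" where
  "qfact4 m = (\<Prod>k<m. 1 - fps_X ^ (4 * Suc k))"

text \<open>\<open>(-q ^ 2; q ^ 2)_m\<close>, the generating function of distinct even parts up to
  \<open>2 * m\<close>.\<close>

definition even_prod :: "nat \<Rightarrow> rat fps" where
  "even_prod m = (\<Prod>k<m. 1 + fps_X ^ (2 * Suc k))"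

lemma qfact4_simps [simp]:
  "qfact4 0 = 1" "qfact4 (Suc m) = qfact4 m * (1 - fps_X ^ (4 * Suc m))"
  by (simp_all add: qfact4_def)

lemma even_prod_simps [simp]:
  "even_prod 0 = 1" "even_prod (Suc m) = even_prod m * (1 + fps_X ^ (2 * Suc m))"
  by (simp_all add: even_prod_def)

lemma qfact4_nth_0: "qfact4 m $ 0 = 1"
  by (induction m) auto

lemma qfact4_nth_eq: "n \<le> m \<Longrightarrow> k \<le> n \<Longrightarrow> qfact4 m $ k = qfact4 n $ k"
  by (induction m rule: dec_induct) (simp_all add: right_diff_distrib fps_X_power_mult_right_nth)

lemma even_prod_nth_eq: "n \<le> m \<Longrightarrow> k \<le> n \<Longrightarrow> even_prod m $ k = even_prod n $ k"
  by (induction m rule: dec_induct) (simp_all add: distrib_left fps_X_power_mult_right_nth del: power_Suc)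

section \<open>Odd parts counted by the parity of their index\<close>

definition index_gf :: "nat \<Rightarrow> nat \<Rightarrow> nat \<Rightarrow> rat fps" where
  "index_gf N i j =
    part_gf (\<lambda>xs. num_odd_indexed_odd_parts xs = i \<and> num_even_indexed_odd_parts xs = j) N"

lemma index_gf_Suc:
  "index_gf (Suc N) i j = index_gf N i j + fps_X ^ Suc N *
    (if odd (Suc N) then (case i of 0 \<Rightarrow> 0 | Suc i' \<Rightarrow> index_gf N j i') else index_gf N j i)"
  by (auto simp: index_gf_def part_gf_Suc conj_commute split: nat.split)
     (simp add: part_gf_def)

text \<open>The four terms use neither of the parts \<open>2 * m + 1\<close> and
  \<open>2 * m + 2\<close>, both, only the even one, only the odd one. With both, the two index
  swaps cancel and the odd part stands in second place, hence \<open>j'\<close>.\<close>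

lemma index_gf_step:
  "index_gf (2 * Suc m) i j = index_gf (2 * m) i j
    + fps_X ^ (4 * m + 3) * (case j of 0 \<Rightarrow> 0 | Suc j' \<Rightarrow> index_gf (2 * m) i j')
    + fps_X ^ (2 * m + 2) * index_gf (2 * m) j i
    + fps_X ^ (2 * m + 1) * (case i of 0 \<Rightarrow> 0 | Suc i' \<Rightarrow> index_gf (2 * m) j i')"
proof -
  have "fps_X ^ (4 * m + 3) = fps_X ^ (2 * m + 2) * (fps_X ^ (2 * m + 1) :: rat fps)"
    unfolding power_add [symmetric] by (rule arg_cong[where f = "(^) fps_X"]) simp
  then show ?thesis
    by (simp add: index_gf_Suc algebra_simps split: nat.split)
qed

text \<open>Only \<open>m\<close> odd numbers are available up to \<open>2 * m\<close>, and parts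
  are distinct.\<close>

lemma index_gf_eq_0: "m < i + j \<Longrightarrow> index_gf (2 * m) i j = 0"
proof (induction m arbitrary: i j)
  case 0
  then show ?case by (auto simp: index_gf_def part_gf_0)
next
  case (Suc m)
  then show ?case
    unfolding index_gf_step by (auto split: nat.split)
qed

text \<open>Setting \<open>m = i + j + r\<close> and clearing denominators avoids subtraction and
  division. After extraction of a common factor, the four terms of \<open>index_gf_step\<close>
  telescope.\<close>

lemma index_gf_formula:
  "index_gf (2 * (i + j + r)) i j * (qfact4 i * qfact4 j * qfact4 r)
    = fps_X ^ (i * (2 * i - 1) + j * (2 * j + 1)) * qfact4 (i + j + r) * even_prod r"
proof (induction "i + j + r" arbitrary: i j r)
  case 0
  then show ?case by (auto simp: index_gf_def part_gf_0)
next
  case (Suc m)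
  define w where "w = (\<lambda>i j :: nat. i * (2 * i - 1) + j * (2 * j + 1))"
  let ?c = "qfact4 i * qfact4 j * qfact4 r"
  \<comment> \<open>Local \<open>i\<close> and \<open>j\<close> are needed because the third term
    uses this with them exchanged. For \<open>r = 0\<close> both sides vanish.\<close>
  have same: "index_gf (2 * m) i j * (qfact4 i * qfact4 j * qfact4 r)
      = fps_X ^ w i j * (1 - fps_X ^ (2 * r)) * (qfact4 m * even_prod r)"
    if "Suc m = i + j + r" for i j
  proof (cases r)
    case 0
    then show ?thesis using that by (simp add: index_gf_eq_0)
  next
    case (Suc s)
    have IH: "index_gf (2 * m) i j * (qfact4 i * qfact4 j * qfact4 s)
        = fps_X ^ w i j * qfact4 m * even_prod s"
      using Suc.hyps(1)[of i j s] that Suc by (simp add: w_def)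
    \<comment> \<open>The new factor of \<open>qfact4 r\<close> is a difference of squares:
      \<open>v\<close> completes \<open>even_prod r\<close>, and \<open>u\<close> remains.\<close>
    define u v :: "rat fps" where "u = 1 - fps_X ^ (2 * r)" and "v = 1 + fps_X ^ (2 * r)"
    have "1 - fps_X ^ (4 * r) = u * v"
      by (simp add: u_def v_def algebra_simps flip: power_add)
    then have q: "qfact4 r = qfact4 s * (u * v)"
      using Suc qfact4_simps(2) by metis
    have e: "even_prod r = even_prod s * v"
      unfolding v_def Suc by (rule even_prod_simps)
    have "index_gf (2 * m) i j * (qfact4 i * qfact4 j * qfact4 r)
        = (index_gf (2 * m) i j * (qfact4 i * qfact4 j * qfact4 s)) * (u * v)"
      by (simp only: q ac_simps)
    also have "\<dots> = fps_X ^ w i j * u * (qfact4 m * even_prod r)"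
      unfolding IH e by (simp only: ac_simps)
    finally show ?thesis
      by (simp only: u_def)
  qed
  have 1: "index_gf (2 * m) i j * ?c
      = fps_X ^ w i j * (1 - fps_X ^ (2 * r)) * (qfact4 m * even_prod r)"
    using same Suc.hyps(2) by simp
  have 2: "fps_X ^ (4 * m + 3) * (case j of 0 \<Rightarrow> 0 | Suc j' \<Rightarrow> index_gf (2 * m) i j') * ?c
      = fps_X ^ w i j * (fps_X ^ (4 * i + 4 * r) * (1 - fps_X ^ (4 * j))) * (qfact4 m * even_prod r)"
  proof (cases j)
    case j: (Suc j')
    have "index_gf (2 * m) i j' * (qfact4 i * qfact4 j' * qfact4 r)
        = fps_X ^ w i j' * qfact4 m * even_prod r"
      using Suc.hyps(1)[of i j' r] Suc.hyps(2) j by (simp add: w_def)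
    then have "fps_X ^ (4 * m + 3) * (1 - fps_X ^ (4 * j)) *
          (index_gf (2 * m) i j' * (qfact4 i * qfact4 j' * qfact4 r))
        = (fps_X ^ (4 * m + 3) * fps_X ^ w i j') * ((1 - fps_X ^ (4 * j)) * (qfact4 m * even_prod r))"
      by (simp add: ac_simps)
    moreover have "4 * m + 3 + w i j' = w i j + (4 * i + 4 * r)"
      using Suc.hyps(2) j by (cases i) (simp_all add: w_def algebra_simps)
    ultimately show ?thesis
      using j by (simp add: ac_simps flip: power_add)
  qed simp
  have 3: "fps_X ^ (2 * m + 2) * index_gf (2 * m) j i * ?c
      = fps_X ^ w i j * (fps_X ^ (4 * i + 2 * r) * (1 - fps_X ^ (2 * r))) * (qfact4 m * even_prod r)"
  proof -
    \<comment> \<open>\<open>w j i\<close> exceeds \<open>w i j\<close> by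
      \<open>2 * i - 2 * j\<close> (as integers), and
      \<open>2 * m + 2 = 2 * (i + j + r)\<close>.\<close>
    have "2 * m + 2 + w j i = w i j + (4 * i + 2 * r)"
      using Suc.hyps(2) by (cases i; cases j) (simp_all add: w_def algebra_simps)
    then have eq: "fps_X ^ (2 * m + 2) * fps_X ^ w j i
        = (fps_X ^ w i j * fps_X ^ (4 * i + 2 * r) :: rat fps)"
      by (simp only: flip: power_add)
    have "Suc m = j + i + r"
      using Suc.hyps(2) by simp
    note same[OF this]
    then have "fps_X ^ (2 * m + 2) * (index_gf (2 * m) j i * (qfact4 j * qfact4 i * qfact4 r))
        = (fps_X ^ (2 * m + 2) * fps_X ^ w j i) * ((1 - fps_X ^ (2 * r)) * (qfact4 m * even_prod r))"
      by (simp only: ac_simps)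
    then show ?thesis
      unfolding eq by (simp only: ac_simps)
  qed
  have 4: "fps_X ^ (2 * m + 1) * (case i of 0 \<Rightarrow> 0 | Suc i' \<Rightarrow> index_gf (2 * m) j i') * ?c
      = fps_X ^ w i j * (fps_X ^ (2 * r) * (1 - fps_X ^ (4 * i))) * (qfact4 m * even_prod r)"
  proof (cases i)
    case i: (Suc i')
    have "index_gf (2 * m) j i' * (qfact4 j * qfact4 i' * qfact4 r)
        = fps_X ^ w j i' * qfact4 m * even_prod r"
      using Suc.hyps(1)[of j i' r] Suc.hyps(2) i by (simp add: w_def ac_simps)
    then have main: "fps_X ^ (2 * m + 1) * (1 - fps_X ^ (4 * i)) *
          (index_gf (2 * m) j i' * (qfact4 j * qfact4 i' * qfact4 r))
        = (fps_X ^ (2 * m + 1) * fps_X ^ w j i') * ((1 - fps_X ^ (4 * i)) * (qfact4 m * even_prod r))"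
      by (simp only: ac_simps)
    have "2 * m + 1 + w j i' = w i j + 2 * r"
      using Suc.hyps(2) i by (cases j) (simp_all add: w_def algebra_simps)
    then have eq: "fps_X ^ (2 * m + 1) * fps_X ^ w j i' = (fps_X ^ w i j * fps_X ^ (2 * r) :: rat fps)"
      by (simp only: flip: power_add)
    have q: "qfact4 i = qfact4 i' * (1 - fps_X ^ (4 * i))"
      unfolding i by (rule qfact4_simps)
    show ?thesis
      using main unfolding eq q unfolding i nat.case by (simp only: ac_simps)
  qed simp
  \<comment> \<open>All monomials cancel except \<open>1\<close> and the one of degree
    \<open>4 * (i + j + r)\<close>, which supplies the last factor of
    \<open>qfact4 (Suc m)\<close>.\<close>
  have sum: "(1 - fps_X ^ (2 * r)) + fps_X ^ (4 * i + 4 * r) * (1 - fps_X ^ (4 * j))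
      + fps_X ^ (4 * i + 2 * r) * (1 - fps_X ^ (2 * r)) + fps_X ^ (2 * r) * (1 - fps_X ^ (4 * i))
      = (1 - fps_X ^ (4 * (i + j + r)) :: rat fps)"
    by (simp add: algebra_simps flip: power_add)
  have "index_gf (2 * Suc m) i j * ?c
      = fps_X ^ w i j * (1 - fps_X ^ (4 * (i + j + r))) * (qfact4 m * even_prod r)"
    unfolding index_gf_step distrib_right 1 2 3 4 sum [symmetric] by (simp only: distrib_left distrib_right)
  then show ?case
    unfolding Suc.hyps(2) [symmetric] w_def qfact4_simps by (simp only: ac_simps)
qed

section \<open>Odd parts counted by residue modulo 4\<close>

text \<open>The elementary symmetric polynomial of degree \<open>i\<close> in the powers \<open>q ^ (4 * k + c)\<close>, \<open>k < m\<close>.\<close>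

fun elem_sym4 :: "nat \<Rightarrow> nat \<Rightarrow> nat \<Rightarrow> rat fps" where
  "elem_sym4 c 0 i = (if i = 0 then 1 else 0)"
| "elem_sym4 c (Suc m) i = elem_sym4 c m i +
    fps_X ^ (4 * m + c) * (case i of 0 \<Rightarrow> 0 | Suc i' \<Rightarrow> elem_sym4 c m i')"

lemma elem_sym4_eq_0: "m < i \<Longrightarrow> elem_sym4 c m i = 0"
  by (induction m arbitrary: i) (auto split: nat.split)

text \<open>The \<open>q\<close>-binomial theorem in base \<open>q ^ 4\<close>, without
  denominators. The exponent is the sum of \<open>4 * k + c\<close> over \<open>k < i\<close>, the
  least degree of a product of \<open>i\<close> distinct powers.\<close>

lemma elem_sym4_formula:
  "elem_sym4 c (i + s) i * (qfact4 i * qfact4 s) = fps_X ^ (2 * i * (i - 1) + c * i) * qfact4 (i + s)"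
proof (induction "i + s" arbitrary: i s)
  case 0
  then show ?case by simp
next
  case (Suc m)
  define w where "w = (\<lambda>i. 2 * i * (i - 1) + c * i)"
  have 1: "elem_sym4 c m i * (qfact4 i * qfact4 s)
      = fps_X ^ w i * (1 - fps_X ^ (4 * s)) * qfact4 m"
  proof (cases s)
    case 0
    then show ?thesis using Suc.hyps(2) by (simp add: elem_sym4_eq_0)
  next
    case s: (Suc t)
    have "elem_sym4 c m i * (qfact4 i * qfact4 t) = fps_X ^ w i * qfact4 m"
      using Suc.hyps(1)[of i t] Suc.hyps(2) s by (simp add: w_def)
    then have "elem_sym4 c m i * (qfact4 i * qfact4 t) * (1 - fps_X ^ (4 * s))
        = fps_X ^ w i * qfact4 m * (1 - fps_X ^ (4 * s))"
      by simp
    then show ?thesis using s by (simp add: ac_simps)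
  qed
  have 2: "fps_X ^ (4 * m + c) * (case i of 0 \<Rightarrow> 0 | Suc i' \<Rightarrow> elem_sym4 c m i') *
      (qfact4 i * qfact4 s) = fps_X ^ w i * (fps_X ^ (4 * s) * (1 - fps_X ^ (4 * i))) * qfact4 m"
  proof (cases i)
    case i: (Suc i')
    have "elem_sym4 c m i' * (qfact4 i' * qfact4 s) = fps_X ^ w i' * qfact4 m"
      using Suc.hyps(1)[of i' s] Suc.hyps(2) i by (simp add: w_def)
    then have "fps_X ^ (4 * m + c) * (1 - fps_X ^ (4 * i)) *
          (elem_sym4 c m i' * (qfact4 i' * qfact4 s))
        = (fps_X ^ (4 * m + c) * fps_X ^ w i') * ((1 - fps_X ^ (4 * i)) * qfact4 m)"
      by (simp add: ac_simps)
    moreover have "4 * m + c + w i' = w i + 4 * s"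
      using Suc.hyps(2) i by (cases i') (simp_all add: w_def algebra_simps)
    ultimately show ?thesis
      using i by (simp add: ac_simps flip: power_add)
  qed simp
  \<comment> \<open>This is the \<open>q\<close>-Pascal rule after clearing denominators.\<close>
  have sum: "(1 - fps_X ^ (4 * s)) + fps_X ^ (4 * s) * (1 - fps_X ^ (4 * i))
      = (1 - fps_X ^ (4 * (i + s)) :: rat fps)"
    by (simp add: algebra_simps flip: power_add)
  have "elem_sym4 c (Suc m) i * (qfact4 i * qfact4 s)
      = fps_X ^ w i * (1 - fps_X ^ (4 * (i + s))) * qfact4 m"
    unfolding elem_sym4.simps distrib_right 1 2 sum [symmetric] by (simp only: distrib_left distrib_right)
  then show ?case
    by (simp add: w_def ac_simps flip: Suc.hyps(2))
qed

definition mod4_gf :: "nat \<Rightarrow> nat \<Rightarrow> nat \<Rightarrow> rat fps" where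
  "mod4_gf N i j = part_gf (\<lambda>xs. num_parts_mod4 1 xs = i \<and> num_parts_mod4 3 xs = j) N"

lemma mod4_gf_Suc:
  "mod4_gf (Suc N) i j = mod4_gf N i j + fps_X ^ Suc N *
    (if Suc N mod 4 = 1 then (case i of 0 \<Rightarrow> 0 | Suc i' \<Rightarrow> mod4_gf N i' j)
     else if Suc N mod 4 = 3 then (case j of 0 \<Rightarrow> 0 | Suc j' \<Rightarrow> mod4_gf N i j')
     else mod4_gf N i j)"
proof -
  have "part_gf (\<lambda>xs. False) N = 0"
    by (simp add: part_gf_def)
  then show ?thesis
    unfolding mod4_gf_def part_gf_Suc num_parts_mod4_simps
    by (simp split: nat.split del: power_Suc)
qed

text \<open>Parts congruent to 1, parts congruent to 3 and even parts are chosen independently. The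
  induction adds the four parts above \<open>4 * m\<close> one at a time.\<close>

lemma mod4_gf_eq_product:
  "mod4_gf (4 * m) i j = elem_sym4 1 m i * elem_sym4 3 m j * even_prod (2 * m)"
proof (induction m arbitrary: i j)
  case 0
  then show ?case by (simp add: mod4_gf_def part_gf_0)
next
  case (Suc m)
  have N: "4 * Suc m = Suc (Suc (Suc (Suc (4 * m))))" by simp
  have mods: "Suc (4 * m) mod 4 = 1" "Suc (Suc (4 * m)) mod 4 = 2"
    "Suc (Suc (Suc (4 * m))) mod 4 = 3" "Suc (Suc (Suc (Suc (4 * m)))) mod 4 = 0"
    by presburger+
  have 1: "mod4_gf (Suc (4 * m)) i j = elem_sym4 1 (Suc m) i * elem_sym4 3 m j * even_prod (2 * m)"
    for i j
    unfolding mod4_gf_Suc mods Suc.IH by (simp add: algebra_simps split: nat.split)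
  have 2: "mod4_gf (Suc (Suc (4 * m))) i j
      = elem_sym4 1 (Suc m) i * elem_sym4 3 m j * even_prod (Suc (2 * m))" for i j
    unfolding mod4_gf_Suc[of "Suc (4 * m)"] mods 1 by (simp add: algebra_simps)
  have 3: "mod4_gf (Suc (Suc (Suc (4 * m)))) i j
      = elem_sym4 1 (Suc m) i * elem_sym4 3 (Suc m) j * even_prod (Suc (2 * m))" for i j
  proof -
    have e: "4 * m + 3 = Suc (Suc (Suc (4 * m)))" by simp
    show ?thesis
      unfolding mod4_gf_Suc[of "Suc (Suc (4 * m))"] mods 2 elem_sym4.simps(2)[of 3] e
      by (simp add: ring_distribs ac_simps del: elem_sym4.simps even_prod_simps power_Suc
          split: nat.split)
  qed
  have e: "even_prod (2 * Suc m)
      = even_prod (Suc (2 * m)) * (1 + fps_X ^ Suc (Suc (Suc (Suc (4 * m)))))"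
    using even_prod_simps(2)[of "Suc (2 * m)"] by (simp del: even_prod_simps power_Suc)
  show ?case
    unfolding N mod4_gf_Suc[of "Suc (Suc (Suc (4 * m)))"] mods 3 e
    by (simp add: ring_distribs ac_simps del: elem_sym4.simps even_prod_simps power_Suc)
qed

text \<open>For \<open>c = 1\<close> and \<open>c = 3\<close> the exponents in
  \<open>elem_sym4_formula\<close> add up to the weight of \<open>index_gf_formula\<close>.\<close>

lemma mod4_gf_formula:
  assumes "i + s = m" "j + t = m"
  shows "mod4_gf (4 * m) i j * (qfact4 i * qfact4 j * (qfact4 s * qfact4 t))
    = fps_X ^ (i * (2 * i - 1) + j * (2 * j + 1)) * (qfact4 m * qfact4 m) * even_prod (2 * m)"
proof -
  have "2 * i * (i - 1) + 1 * i = i * (2 * i - 1)"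
    by (cases i) simp_all
  then have 1: "elem_sym4 1 m i * (qfact4 i * qfact4 s) = fps_X ^ (i * (2 * i - 1)) * qfact4 m"
    using elem_sym4_formula[of 1 i s] assms by simp
  have "2 * j * (j - 1) + 3 * j = j * (2 * j + 1)"
    by (cases j) simp_all
  then have 3: "elem_sym4 3 m j * (qfact4 j * qfact4 t) = fps_X ^ (j * (2 * j + 1)) * qfact4 m"
    using elem_sym4_formula[of 3 j t] assms by simp
  have "mod4_gf (4 * m) i j * (qfact4 i * qfact4 j * (qfact4 s * qfact4 t))
      = (elem_sym4 1 m i * (qfact4 i * qfact4 s)) * (elem_sym4 3 m j * (qfact4 j * qfact4 t))
        * even_prod (2 * m)"
    unfolding mod4_gf_eq_product by (simp only: ac_simps)
  then show ?thesis
    unfolding 1 3 by (simp add: power_add ac_simps)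
qed

section \<open>Comparison of low-order coefficients\<close>

text \<open>Congruence modulo \<open>q ^ (n + 1)\<close>; it replaces the limit of growing
  \<open>m\<close>.\<close>

definition fps_agree :: "nat \<Rightarrow> 'a fps \<Rightarrow> 'a fps \<Rightarrow> bool" where
  "fps_agree n f g \<longleftrightarrow> (\<forall>k\<le>n. f $ k = g $ k)"

lemma fps_agree_refl: "fps_agree n f f"
  by (simp add: fps_agree_def)

lemma fps_agree_trans [trans]: "fps_agree n f g \<Longrightarrow> fps_agree n g h \<Longrightarrow> fps_agree n f h"
  by (simp add: fps_agree_def)

lemma fps_agree_mult:
  fixes f g :: "'a::semiring_0 fps"
  shows "fps_agree n f f' \<Longrightarrow> fps_agree n g g' \<Longrightarrow> fps_agree n (f * g) (f' * g')"
  by (auto simp: fps_agree_def fps_mult_nth intro!: sum.cong)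

lemma fps_agree_cancel:
  fixes f g u :: "'a::field fps"
  assumes "fps_agree n (f * u) (g * u)" "u $ 0 \<noteq> 0"
  shows "fps_agree n f g"
proof -
  have "fps_agree n (f * u * inverse u) (g * u * inverse u)"
    by (rule fps_agree_mult[OF assms(1) fps_agree_refl])
  then show ?thesis
    by (simp only: mult.assoc inverse_mult_eq_1'[OF assms(2)] mult_1_right)
qed

text \<open>This \<open>m\<close> gives \<open>r = n\<close>, \<open>s = j + n\<close> and
  \<open>t = i + n\<close>. All are at least \<open>n\<close>, so the products with these
  subscripts, or with \<open>m\<close> or \<open>2 * m\<close>, may be truncated at
  \<open>n\<close>.\<close>

lemma index_gf_agree_mod4_gf:
  fixes i j n :: nat
  defines "m \<equiv> i + j + n"
  shows "fps_agree n (index_gf (2 * m) i j) (mod4_gf (4 * m) i j)"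
proof (rule fps_agree_cancel)
  let ?A = "index_gf (2 * m) i j" and ?D = "mod4_gf (4 * m) i j"
  let ?u = "qfact4 i * qfact4 j" and ?q = "qfact4 n" and ?e = "even_prod n"
  let ?w = "fps_X ^ (i * (2 * i - 1) + j * (2 * j + 1)) :: rat fps"
  have q: "fps_agree n (qfact4 k) ?q" and q': "fps_agree n ?q (qfact4 k)"
    and e: "fps_agree n (even_prod k) ?e" if "n \<le> k" for k
    using that qfact4_nth_eq even_prod_nth_eq by (auto simp: fps_agree_def)
  \<comment> \<open>\<open>?A\<close> needs only one \<open>?q\<close>; the second matches the two
    complementary denominators of \<open>?D\<close>.\<close>
  have "?A * (?u * (?q * ?q)) = ?A * (?u * ?q) * ?q"
    by (simp only: ac_simps)
  also have "\<dots> = ?w * qfact4 m * ?e * ?q"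
    unfolding m_def index_gf_formula ..
  also have "fps_agree n \<dots> (?w * ?q * ?e * ?q)"
    by (intro fps_agree_mult fps_agree_refl q) (simp add: m_def)
  finally have A: "fps_agree n (?A * (?u * (?q * ?q))) (?w * ?q * ?e * ?q)" .
  have "fps_agree n (?D * (?u * (?q * ?q))) (?D * (?u * (qfact4 (j + n) * qfact4 (i + n))))"
    by (intro fps_agree_mult fps_agree_refl q') auto
  also have "?D * (?u * (qfact4 (j + n) * qfact4 (i + n)))
      = ?w * (qfact4 m * qfact4 m) * even_prod (2 * m)"
    by (rule mod4_gf_formula) (simp_all add: m_def)
  also have "fps_agree n \<dots> (?w * (?q * ?q) * ?e)"
    by (intro fps_agree_mult fps_agree_refl q e) (simp_all add: m_def)
  also have "?w * (?q * ?q) * ?e = ?w * ?q * ?e * ?q"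
    by (simp only: ac_simps)
  finally show "fps_agree n (?A * (?u * (?q * ?q))) (?D * (?u * (?q * ?q)))"
    using A by (simp add: fps_agree_def)
  show "(?u * (?q * ?q)) $ 0 \<noteq> 0"
    by (simp add: qfact4_nth_0)
qed

theorem theorem1p1:
  fixes i j n :: nat
  shows "num_partitions_by_index i j n = num_partitions_by_mod4 i j n"
proof -
  \<comment> \<open>Both bounds \<open>2 * m\<close> and \<open>4 * m\<close> are at least
    \<open>n\<close>, so \<open>part_gf_nth\<close> reads off the counts.\<close>
  define m where "m = i + j + n"
  have "(of_nat (num_partitions_by_index i j n) :: rat) = index_gf (2 * m) i j $ n"
    by (simp add: num_partitions_by_index_def index_gf_def part_gf_nth m_def)
  also have "\<dots> = mod4_gf (4 * m) i j $ n"
    using index_gf_agree_mod4_gf[of n i j] by (simp add: fps_agree_def m_def)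
  also have "\<dots> = of_nat (num_partitions_by_mod4 i j n)"
    by (simp add: num_partitions_by_mod4_def mod4_gf_def part_gf_nth m_def)
  finally show ?thesis by simp
qed

end
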